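(* Let $n\ge 1$ be an integer and let $\alpha_i,\beta_i,\gamma_i$ ($i=1,\dots,n$) be real numbers with $\min(\alpha_i,\gamma_i)\ge 1$ and $\beta_i>0$ for all $i=1,\dots,n$, and with $\alpha_j+\beta_j\ge 2$ for some $j\in\{1,\dots,n\}$. Let $$\mathbf{F}(z)=z\prod_{i=1}^{n}[\Gamma(\beta_i)]^{\gamma_i}\sum_{m=0}^{\infty}\frac{z^{m}}{\prod_{i=1}^{n}[\Gamma(\alpha_i m+\beta_i)]^{\gamma_i}}$$ and $\mathcal{D}_{1/2}=\{z\in\mathbb{C}:|z|<1/2\}$. Then the following assertions hold. (a) If $(e-1)\prod_{i=1}^{n}[\Gamma(\beta_i)]^{\gamma_i}<\prod_{i=1}^{n}[\Gamma(\alpha_i+\beta_i)]^{\gamma_i}$, then $\mathbf{F}$ is starlike in $\mathcal{D}_{1/2}$. (b) If $2(e-1)\prod_{i=1}^{n}[\Gamma(\beta_i)]^{\gamma_i}<\prod_{i=1}^{n}[\Gamma(\alpha_i+\beta_i)]^{\gamma_i}$ and $\beta_i\ge 2$ for all $i=1,\dots,n$, then $\mathbf{F}$ is convex in $\mathcal{D}_{1/2}$.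
   Context: $\Gamma$ is the Euler gamma function. For an analytic function $f$ with $f(0)=f'(0)-1=0$: $f$ is starlike in a disk centred at $0$ if it is univalent there and $\operatorname{Re}\left(\frac{zf'(z)}{f(z)}\right)>0$ for all $z$ in that disk (the quotient being $1$ at $z=0$); $f$ is convex in the disk if it is univalent there and $\operatorname{Re}\left(1+\frac{zf''(z)}{f'(z)}\right)>0$ for all $z$ in that disk. *)

theory Defs
  imports "HOL-Analysis.Analysis" "HOL-Complex_Analysis.Complex_Analysis"
begin

text \<open>
  The real powers are taken with \<^const>\<open>powr\<close>, which is meant for positive bases; for
  \<open>\<alpha> i \<ge> 1\<close> and \<open>\<beta> i > 0\<close> every Gamma value below is positive. For \<open>\<alpha> i \<ge> 1\<close>, \<open>\<gamma> i \<ge> 1\<close> and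
  \<open>n \<ge> 1\<close> the power series converges on the whole plane.
\<close>

definition le_roy_F :: "nat \<Rightarrow> (nat \<Rightarrow> real) \<Rightarrow> (nat \<Rightarrow> real) \<Rightarrow> (nat \<Rightarrow> real) \<Rightarrow> complex \<Rightarrow> complex" where
  "le_roy_F n \<alpha> \<beta> \<gamma> z =
     z * of_real (\<Prod>i=1..n. Gamma (\<beta> i) powr \<gamma> i) *
       (\<Sum>m. z ^ m / of_real (\<Prod>i=1..n. Gamma (\<alpha> i * real m + \<beta> i) powr \<gamma> i))"

definition normalized_univalent_in_disk :: "(complex \<Rightarrow> complex) \<Rightarrow> real \<Rightarrow> bool" where
  "normalized_univalent_in_disk f r \<longleftrightarrow>
     f holomorphic_on ball 0 r \<and> f 0 = 0 \<and> deriv f 0 = 1 \<and> inj_on f (ball 0 r)"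

text \<open>
  Univalence and \<open>f 0 = 0\<close> give \<open>f z \<noteq> 0\<close> for \<open>z \<noteq> 0\<close>, and univalence gives \<open>deriv f z \<noteq> 0\<close>, so no
  division by zero occurs in the two conditions below other than at \<open>z = 0\<close> in the first,
  where the quotient is extended by its limit.
\<close>

definition starlike_in_disk :: "(complex \<Rightarrow> complex) \<Rightarrow> real \<Rightarrow> bool" where
  "starlike_in_disk f r \<longleftrightarrow> normalized_univalent_in_disk f r \<and>
     (\<forall>z\<in>ball 0 r. Re (if z = 0 then 1 else z * deriv f z / f z) > 0)"

definition convex_in_disk :: "(complex \<Rightarrow> complex) \<Rightarrow> real \<Rightarrow> bool" where
  "convex_in_disk f r \<longleftrightarrow> normalized_univalent_in_disk f r \<and>
     (\<forall>z\<in>ball 0 r. Re (1 + z * deriv (deriv f) z / deriv f z) > 0)"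

end

theory Submission imports Defs begin

text \<open>
  Write \<open>F z = z * g z\<close> with \<open>g z = (\<Sum>m. a m * z ^ m)\<close> and \<open>a 0 = 1\<close>, and let \<open>r\<close> be the radius.
  Both assertions follow from one coefficient estimate. If
  \<open>(\<Sum>m. (m + 1) * \<bar>a m\<bar> * r ^ m) < 2\<close>, that is, if the terms with \<open>m \<ge> 1\<close> add up to less than
  \<open>1\<close>, then \<open>\<bar>g z - 1\<bar> + \<bar>z * g' z\<bar> < 1\<close> for \<open>\<bar>z\<bar> < r\<close>. Since \<open>F' = g + z * g'\<close>, this gives
  \<open>\<bar>F' - 1\<bar> < 1\<close>, hence univalence, and \<open>\<bar>z * g' z\<bar> < \<bar>g z\<bar>\<close>, hence
  \<open>z * F' z / F z = 1 + z * g' z / g z\<close> has positive real part. For convexity the same estimate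
  is applied to the series of \<open>F'\<close>, whose coefficients are \<open>(m + 1) * a m\<close>, because
  \<open>1 + z * F'' z / F' z\<close> is built from \<open>F'\<close> as \<open>z * F' z / F z\<close> is built from \<open>g\<close>.

  The radius \<open>1/2\<close> enters through \<open>(m + 1) / 2 ^ m \<le> 1\<close>: it suffices that the unweighted
  coefficients with \<open>m \<ge> 1\<close> have sum below \<open>1\<close>, and this holds if they are at most \<open>A / m!\<close> with
  \<open>A * (e - 1) < 1\<close>.

  Finally, \<open>x * \<Gamma> x \<le> \<Gamma> (x + \<alpha>)\<close> for \<open>x, \<alpha> \<ge> 1\<close> controls the quotient
  \<open>a (m + 1) / a m\<close> for \<open>m \<ge> 1\<close>: the index with \<open>\<alpha> j + \<beta> j \<ge> 2\<close> contributes a factor of at most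
  \<open>1 / (m + 1)\<close> and the others at most \<open>1\<close>, so \<open>a m \<le> a 1 / m!\<close>. If \<open>\<beta> j \<ge> 2\<close> the factor
  improves to \<open>1 / (m + 2)\<close>, so \<open>(m + 1) * a m \<le> 2 * a 1 / m!\<close>. The hypotheses of the two
  assertions are exactly \<open>A * (e - 1) < 1\<close> for \<open>A = a 1\<close> and \<open>A = 2 * a 1\<close>.
\<close>

section \<open>Power series with small weighted coefficients\<close>

lemma powser_zderiv:
  fixes b :: "nat \<Rightarrow> complex"
  assumes sm: "summable (\<lambda>m. real (m + 1) * norm (b m) * r ^ m)" and z: "norm z < r"
  defines "g \<equiv> \<lambda>z. \<Sum>m. b m * z ^ m"
  shows "summable (\<lambda>m. b m * z ^ m)"
    and "(g has_field_derivative deriv g z) (at z)"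
    and "(\<lambda>m. of_nat m * b m * z ^ m) sums (z * deriv g z)"
proof -
  have r: "0 < r" using z norm_ge_zero[of z] by linarith
  have sr: "summable (\<lambda>m. b m * of_real r ^ m)"
    by (rule summable_comparison_test'[OF sm, of 0])
       (use r in \<open>auto simp: norm_mult norm_power intro!: mult_right_mono mult_le_cancel_right1[THEN iffD2]\<close>)
  have s: "summable (\<lambda>m. b m * w ^ m)" if "norm w < r" for w
    by (rule powser_inside[OF sr]) (use that r in simp)
  show "summable (\<lambda>m. b m * z ^ m)" by (rule s[OF z])
  have d: "(g has_field_derivative (\<Sum>m. diffs b m * z ^ m)) (at z)"
    unfolding g_def by (rule termdiffs_strong[OF sr]) (use z r in simp)
  then have dv: "deriv g z = (\<Sum>m. diffs b m * z ^ m)" by (rule DERIV_imp_deriv)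
  with d show "(g has_field_derivative deriv g z) (at z)" by simp
  have "summable (\<lambda>m. diffs b m * z ^ m)"
    by (rule termdiff_converges[OF z s])
  from sums_mult[OF diffs_equiv[OF this], of z]
  have "(\<lambda>m. z * (of_nat m * b m * z ^ (m - Suc 0))) sums (z * deriv g z)"
    unfolding dv .
  moreover have "z * (of_nat m * b m * z ^ (m - Suc 0)) = of_nat m * b m * z ^ m" for m
    by (cases m) auto
  ultimately show "(\<lambda>m. of_nat m * b m * z ^ m) sums (z * deriv g z)" by simp
qed

text \<open>
  The weight \<open>m + 1\<close> splits as \<open>1 + m\<close>: the part \<open>1\<close> majorizes \<open>g - 1\<close> and the part \<open>m\<close>
  majorizes \<open>z * g'\<close>. The term \<open>m = 0\<close> of the majorant is \<open>1\<close>, whence the subtraction.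
\<close>

lemma norm_powser_zderiv_le:
  fixes b :: "nat \<Rightarrow> complex"
  assumes sm: "summable (\<lambda>m. real (m + 1) * norm (b m) * r ^ m)" and z: "norm z < r"
    and b0: "b 0 = 1"
  defines "g \<equiv> \<lambda>z. \<Sum>m. b m * z ^ m"
  shows "norm (g z - 1) + norm (z * deriv g z) \<le> (\<Sum>m. real (m + 1) * norm (b m) * r ^ m) - 1"
proof -
  have r: "0 < r" using z norm_ge_zero[of z] by linarith
  have zr: "norm z ^ m \<le> r ^ m" for m
    using z by (intro power_mono) auto
  have s1: "summable (\<lambda>m. norm (b m) * r ^ m)"
    by (rule summable_comparison_test'[OF sm, of 0])
       (use r in \<open>auto intro!: mult_right_mono mult_le_cancel_right1[THEN iffD2]\<close>)
  have s2: "summable (\<lambda>m. real m * norm (b m) * r ^ m)"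
    by (rule summable_comparison_test'[OF sm, of 0]) (use r in \<open>auto intro!: mult_right_mono\<close>)
  have split: "(\<Sum>m. norm (b m) * r ^ m) + (\<Sum>m. real m * norm (b m) * r ^ m)
      = (\<Sum>m. real (m + 1) * norm (b m) * r ^ m)"
    by (subst suminf_add[OF s1 s2]) (simp add: algebra_simps)
  have one: "(\<lambda>m::nat. if m = 0 then 1 else 0) sums (1::'a::real_normed_field)"
    using sums_single[of 0 "\<lambda>_. 1::'a"] by simp
  have "norm (g z - 1) \<le> (\<Sum>m. norm (b m) * r ^ m) - 1"
  proof (rule norm_sums_le)
    show "(\<lambda>m. b m * z ^ m - (if m = 0 then 1 else 0)) sums (g z - 1)"
      unfolding g_def
      by (intro sums_diff one summable_sums powser_zderiv(1)[OF sm z])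
    show "(\<lambda>m. norm (b m) * r ^ m - (if m = 0 then 1 else 0)) sums ((\<Sum>m. norm (b m) * r ^ m) - 1)"
      by (intro sums_diff one summable_sums s1)
    show "norm (b m * z ^ m - (if m = 0 then 1 else 0)) \<le> norm (b m) * r ^ m - (if m = 0 then 1 else 0)"
      for m
      using zr[of m] b0 by (auto simp: norm_mult norm_power mult_left_mono)
  qed
  moreover have "norm (z * deriv g z) \<le> (\<Sum>m. real m * norm (b m) * r ^ m)"
  proof (rule norm_sums_le)
    show "(\<lambda>m. of_nat m * b m * z ^ m) sums (z * deriv g z)"
      unfolding g_def by (rule powser_zderiv(3)[OF sm z])
    show "(\<lambda>m. real m * norm (b m) * r ^ m) sums (\<Sum>m. real m * norm (b m) * r ^ m)"
      by (rule summable_sums[OF s2])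
    show "norm (of_nat m * b m * z ^ m) \<le> real m * norm (b m) * r ^ m" for m
      using zr[of m] by (auto simp: norm_mult norm_power intro!: mult_left_mono)
  qed
  ultimately show ?thesis using split by linarith
qed

lemma Re_one_plus_divide_pos:
  fixes u v :: complex
  assumes "norm (v - 1) + norm u < 1"
  shows "Re (1 + u / v) > 0"
proof -
  have "1 \<le> norm v + norm (v - 1)" using norm_triangle_ineq4[of v "v - 1"] by simp
  then have uv: "norm u < norm v" using assms by linarith
  then have "0 < norm v" by (rule le_less_trans[OF norm_ge_zero])
  with uv have "norm (u / v) < 1" by (simp add: norm_divide)
  then show ?thesis using complex_Re_le_cmod[of "- (u / v)"] by simp
qed

section \<open>Coefficient criteria for starlikeness and convexity\<close>

lemma has_field_derivative_z_times_powser: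
  fixes b :: "nat \<Rightarrow> complex"
  assumes sm: "summable (\<lambda>m. real (m + 1) * norm (b m) * r ^ m)" and z: "norm z < r"
    and f: "\<And>z. norm z < r \<Longrightarrow> f z = z * (\<Sum>m. b m * z ^ m)"
  defines "g \<equiv> \<lambda>z. \<Sum>m. b m * z ^ m"
  shows "(f has_field_derivative (g z + z * deriv g z)) (at z)"
proof -
  have "((\<lambda>z. z * g z) has_field_derivative (g z + z * deriv g z)) (at z)"
    using powser_zderiv(2)[OF sm z] unfolding g_def by (auto intro!: derivative_eq_intros)
  then show ?thesis
    by (rule has_field_derivative_transform_within_open[of _ _ _ "ball 0 r"])
       (use z f in \<open>auto simp: g_def\<close>)
qed

text \<open>
  Since \<open>f' - 1 = (g - 1) + z * g'\<close> has norm at most some \<open>K < 1\<close>, the map \<open>f - id\<close> contracts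
  distances by the factor \<open>K\<close>, so \<open>f\<close> cannot identify two points.
\<close>

lemma normalized_univalent_criterion:
  fixes b :: "nat \<Rightarrow> complex"
  assumes r: "0 < r" and b0: "b 0 = 1"
    and sm: "summable (\<lambda>m. real (m + 1) * norm (b m) * r ^ m)"
    and lt: "(\<Sum>m. real (m + 1) * norm (b m) * r ^ m) < 2"
    and f: "\<And>z. norm z < r \<Longrightarrow> f z = z * (\<Sum>m. b m * z ^ m)"
  shows "normalized_univalent_in_disk f r"
proof -
  define g where "g = (\<lambda>z. \<Sum>m. b m * z ^ m)"
  define K where "K = (\<Sum>m. real (m + 1) * norm (b m) * r ^ m) - 1"
  have d: "(f has_field_derivative (g z + z * deriv g z)) (at z)" if "norm z < r" for z
    unfolding g_def by (rule has_field_derivative_z_times_powser[OF sm that f])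
  have bound: "norm ((g z + z * deriv g z) - 1) \<le> K" if "norm z < r" for z
    using norm_powser_zderiv_le[OF sm that b0] norm_triangle_ineq[of "g z - 1" "z * deriv g z"]
    unfolding g_def K_def by (simp add: algebra_simps)
  have "inj_on f (ball 0 r)"
  proof (rule inj_onI)
    fix x y assume x: "x \<in> ball 0 r" and y: "y \<in> ball 0 r" and e: "f x = f y"
    have "norm ((f x - x) - (f y - y)) \<le> K * norm (x - y)"
    proof (rule field_differentiable_bound[where f = "\<lambda>z. f z - z"])
      show "((\<lambda>z. f z - z) has_field_derivative ((g z + z * deriv g z) - 1)) (at z within ball 0 r)"
        if "z \<in> ball 0 r" for z
        using that by (intro DERIV_diff DERIV_ident has_field_derivative_at_within[OF d]) auto
    qed (use x y bound in auto)
    then have "norm (x - y) * (1 - K) \<le> 0"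
      using e by (simp add: algebra_simps norm_minus_commute)
    moreover have "1 - K > 0" using lt by (simp add: K_def)
    ultimately have "norm (x - y) \<le> 0" by (simp add: mult_le_0_iff)
    then show "x = y" by simp
  qed
  moreover have "f holomorphic_on ball 0 r"
    unfolding holomorphic_on_open[OF open_ball] using d by (meson mem_ball_0)
  moreover have "deriv f 0 = 1"
    using DERIV_imp_deriv[OF d[of 0]] r b0 by (simp add: g_def)
  moreover have "f 0 = 0" using f[of 0] r by simp
  ultimately show ?thesis by (simp add: normalized_univalent_in_disk_def)
qed

lemma starlike_criterion:
  fixes b :: "nat \<Rightarrow> complex"
  assumes r: "0 < r" and b0: "b 0 = 1"
    and sm: "summable (\<lambda>m. real (m + 1) * norm (b m) * r ^ m)"
    and lt: "(\<Sum>m. real (m + 1) * norm (b m) * r ^ m) < 2"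
    and f: "\<And>z. norm z < r \<Longrightarrow> f z = z * (\<Sum>m. b m * z ^ m)"
  shows "starlike_in_disk f r"
proof -
  define g where "g = (\<lambda>z. \<Sum>m. b m * z ^ m)"
  have "Re (z * deriv f z / f z) > 0" if z: "norm z < r" and "z \<noteq> 0" for z
  proof -
    have small: "norm (g z - 1) + norm (z * deriv g z) < 1"
      using norm_powser_zderiv_le[OF sm z b0] lt unfolding g_def by linarith
    then have "g z \<noteq> 0" by auto
    moreover have "deriv f z = g z + z * deriv g z"
      unfolding g_def by (rule DERIV_imp_deriv[OF has_field_derivative_z_times_powser[OF sm z f]])
    moreover have "f z = z * g z" using f[OF z] by (simp add: g_def)
    ultimately have "z * deriv f z / f z = 1 + z * deriv g z / g z"
      using \<open>z \<noteq> 0\<close> by (simp add: field_simps)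
    then show ?thesis using Re_one_plus_divide_pos[OF small] by simp
  qed
  then show ?thesis
    using normalized_univalent_criterion[OF r b0 sm lt f] by (simp add: starlike_in_disk_def)
qed

text \<open>
  Alexander's correspondence on the level of coefficients: \<open>f'\<close> has the coefficients
  \<open>(m + 1) * b m\<close>, and \<open>1 + z * f'' / f'\<close> is bounded as \<open>1 + z * g' / g\<close> was.
\<close>

lemma convex_criterion:
  fixes b :: "nat \<Rightarrow> complex"
  assumes r: "0 < r" and b0: "b 0 = 1"
    and sm: "summable (\<lambda>m. real (m + 1) * (real (m + 1) * norm (b m)) * r ^ m)"
    and lt: "(\<Sum>m. real (m + 1) * (real (m + 1) * norm (b m)) * r ^ m) < 2"
    and f: "\<And>z. norm z < r \<Longrightarrow> f z = z * (\<Sum>m. b m * z ^ m)"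
  shows "convex_in_disk f r"
proof -
  define c where "c m = of_nat (m + 1) * b m" for m
  have nc: "norm (c m) = real (m + 1) * norm (b m)" for m
    unfolding c_def norm_mult norm_of_nat ..
  have smc: "summable (\<lambda>m. real (m + 1) * norm (c m) * r ^ m)"
    and ltc: "(\<Sum>m. real (m + 1) * norm (c m) * r ^ m) < 2"
    using sm lt unfolding nc by auto
  have c0: "c 0 = 1" by (simp add: c_def b0)
  have le: "real (m + 1) * norm (b m) * r ^ m \<le> real (m + 1) * (real (m + 1) * norm (b m)) * r ^ m" for m
  proof -
    have "1 * (real (m + 1) * norm (b m) * r ^ m) \<le> real (m + 1) * (real (m + 1) * norm (b m) * r ^ m)"
      using r by (intro mult_right_mono) auto
    then show ?thesis by (simp add: mult.assoc)
  qed
  have smb: "summable (\<lambda>m. real (m + 1) * norm (b m) * r ^ m)"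
    by (rule summable_comparison_test'[OF sm, of 0]) (use le r in auto)
  have ltb: "(\<Sum>m. real (m + 1) * norm (b m) * r ^ m) < 2"
    using suminf_le[OF le smb sm] lt by linarith
  define g where "g = (\<lambda>z. \<Sum>m. b m * z ^ m)"
  define h where "h = (\<lambda>z. \<Sum>m. c m * z ^ m)"
  have df: "deriv f z = h z" if z: "norm z < r" for z
  proof -
    have "deriv f z = g z + z * deriv g z"
      unfolding g_def by (rule DERIV_imp_deriv[OF has_field_derivative_z_times_powser[OF smb z f]])
    moreover have "(\<lambda>m. b m * z ^ m + of_nat m * b m * z ^ m) sums (g z + z * deriv g z)"
      unfolding g_def
      by (intro sums_add summable_sums powser_zderiv[OF smb z])
    then have "h z = g z + z * deriv g z"
      unfolding h_def c_def by (simp add: sums_iff algebra_simps)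
    ultimately show ?thesis by simp
  qed
  have "Re (1 + z * deriv (deriv f) z / deriv f z) > 0" if z: "norm z < r" for z
  proof -
    have "eventually (\<lambda>w. w \<in> ball 0 r) (nhds z)"
      using z by (intro eventually_nhds_in_open) auto
    then have "eventually (\<lambda>w. deriv f w = h w) (nhds z)"
      by eventually_elim (auto intro: df)
    then have "deriv (deriv f) z = deriv h z" by (intro deriv_cong_ev) auto
    moreover have "norm (h z - 1) + norm (z * deriv h z) < 1"
      using norm_powser_zderiv_le[OF smc z c0] ltc unfolding h_def by linarith
    ultimately show ?thesis using Re_one_plus_divide_pos df[OF z] by simp
  qed
  then show ?thesis
    using normalized_univalent_criterion[OF r b0 smb ltb f] by (simp add: convex_in_disk_def)
qed

text \<open>
  At radius \<open>1/2\<close> the weight is harmless, as \<open>m + 1 \<le> 2 ^ m\<close>. The majorant sums to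
  \<open>1 + A * (e - 1)\<close>; its term at \<open>m = 0\<close> has to be corrected from \<open>A / 0!\<close> to \<open>1\<close>.
\<close>

lemma weighted_coeff_sum_half:
  fixes t :: "nat \<Rightarrow> real"
  assumes t0: "t 0 = 1" and nonneg: "\<And>m. t m \<ge> 0"
    and le: "\<And>m. m \<ge> 1 \<Longrightarrow> t m \<le> A / fact m" and A: "A * (exp 1 - 1) < 1"
  shows "summable (\<lambda>m. real (m + 1) * t m * (1/2) ^ m)"
    and "(\<Sum>m. real (m + 1) * t m * (1/2) ^ m) < 2"
proof -
  define u where "u m = A / fact m + (if m = 0 then 1 - A else 0)" for m :: nat
  have "(\<lambda>m. 1 / fact m :: real) sums exp 1"
    using exp_converges[of "1::real"] by (simp add: field_simps)
  from sums_mult[OF this, of A]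
  have "(\<lambda>m. A / fact m) sums (A * exp 1)" by simp
  then have us: "u sums (A * exp 1 + (1 - A))"
    unfolding u_def using sums_single[of 0 "\<lambda>_. 1 - A"] by (intro sums_add) auto
  have half: "real (m + 1) * (1/2) ^ m \<le> 1" for m
  proof -
    have "m + 1 \<le> 2 ^ m" by (induction m) auto
    then have "real (m + 1) \<le> real (2 ^ m)" by (rule of_nat_mono)
    then show ?thesis by (simp add: power_one_over field_simps)
  qed
  have tu: "real (m + 1) * t m * (1/2) ^ m \<le> u m" for m
  proof -
    have "t m * (real (m + 1) * (1/2) ^ m) \<le> t m * 1"
      by (rule mult_left_mono[OF half nonneg])
    also have "\<dots> \<le> u m" using t0 le[of m] by (auto simp: u_def)
    finally show ?thesis by (simp only: ac_simps)
  qed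
  show sm: "summable (\<lambda>m. real (m + 1) * t m * (1/2) ^ m)"
    by (rule summable_comparison_test'[OF sums_summable[OF us], of 0])
       (use tu nonneg in \<open>auto simp: abs_mult\<close>)
  have "(\<Sum>m. real (m + 1) * t m * (1/2) ^ m) \<le> suminf u"
    by (rule suminf_le[OF tu sm sums_summable[OF us]])
  also have "\<dots> = A * exp 1 + (1 - A)" using us by (simp add: sums_iff)
  also have "\<dots> < 2" using A by (simp add: algebra_simps)
  finally show "(\<Sum>m. real (m + 1) * t m * (1/2) ^ m) < 2" .
qed

section \<open>Growth of products of Gamma values\<close>

lemma mult_Gamma_le_Gamma_add:
  fixes x a :: real
  assumes "x \<ge> 1" "a \<ge> 1"
  shows "x * Gamma x \<le> Gamma (x + a)"
proof -
  have "x * Gamma x = Gamma (x + 1)"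
    using Gamma_plus1[of x] assms by (force elim!: nonpos_Ints_cases')
  also have "\<dots> \<le> Gamma (x + a)"
    \<comment> \<open>here \<open>x + 1 \<ge> 2\<close>, to the right of the minimum of the Gamma function\<close>
    using Gamma_real_strict_mono[of "x + 1" "x + a"] assms by (cases "a = 1") auto
  finally show ?thesis .
qed

text \<open>
  Each argument step \<open>x i \<mapsto> x i + a i\<close> gains at least \<open>x i powr c i \<ge> x i \<ge> 1\<close>; only the gain at
  \<open>j\<close> is kept.
\<close>

lemma prod_Gamma_powr_growth:
  fixes x a c :: "'i \<Rightarrow> real"
  assumes fin: "finite I" and j: "j \<in> I"
    and ge: "\<And>i. i \<in> I \<Longrightarrow> x i \<ge> 1" "\<And>i. i \<in> I \<Longrightarrow> a i \<ge> 1" "\<And>i. i \<in> I \<Longrightarrow> c i \<ge> 1"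
  shows "x j * (\<Prod>i\<in>I. Gamma (x i) powr c i) \<le> (\<Prod>i\<in>I. Gamma (x i + a i) powr c i)"
proof -
  have "x j \<le> (\<Prod>i\<in>I. x i)"
  proof -
    have "1 \<le> (\<Prod>i\<in>I - {j}. x i)" using ge(1) by (intro prod_ge_1) auto
    then have "x j * 1 \<le> x j * (\<Prod>i\<in>I - {j}. x i)"
      using ge(1)[OF j] by (intro mult_left_mono) auto
    then show ?thesis using prod.remove[OF fin j, of x] by simp
  qed
  then have "x j * (\<Prod>i\<in>I. Gamma (x i) powr c i) \<le> (\<Prod>i\<in>I. x i) * (\<Prod>i\<in>I. Gamma (x i) powr c i)"
    by (intro mult_right_mono prod_nonneg) auto
  also have "\<dots> = (\<Prod>i\<in>I. x i * Gamma (x i) powr c i)" by (rule prod.distrib[symmetric])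
  also have "\<dots> \<le> (\<Prod>i\<in>I. Gamma (x i + a i) powr c i)"
  proof (rule prod_mono)
    fix i assume i: "i \<in> I"
    have pos: "x i > 0" "Gamma (x i) > 0" using ge(1)[OF i] by (auto intro!: Gamma_real_pos)
    have "x i * Gamma (x i) powr c i \<le> x i powr c i * Gamma (x i) powr c i"
      using powr_mono[of 1 "c i" "x i"] ge(1,3)[OF i] by (intro mult_right_mono) auto
    also have "\<dots> = (x i * Gamma (x i)) powr c i" using pos by (simp add: powr_mult)
    also have "\<dots> \<le> Gamma (x i + a i) powr c i"
      using pos ge[OF i] mult_Gamma_le_Gamma_add[of "x i" "a i"] by (intro powr_mono2) auto
    finally show "0 \<le> x i * Gamma (x i) powr c i \<and> x i * Gamma (x i) powr c i \<le> Gamma (x i + a i) powr c i"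
      using pos by auto
  qed
  finally show ?thesis .
qed

text \<open>
  The parameter \<open>k\<close> covers both growth rates that occur: \<open>k = 0\<close> for \<open>\<alpha> j + \<beta> j \<ge> 2\<close> and \<open>k = 1\<close>
  for \<open>\<beta> j \<ge> 2\<close>.
\<close>

lemma prod_Gamma_powr_ge_fact:
  fixes \<alpha> \<beta> \<gamma> :: "'i \<Rightarrow> real"
  defines "P \<equiv> \<lambda>I m. \<Prod>i\<in>I. Gamma (\<alpha> i * real m + \<beta> i) powr \<gamma> i"
  assumes fin: "finite I" and j: "j \<in> I"
    and ge: "\<And>i. i \<in> I \<Longrightarrow> \<alpha> i \<ge> 1" "\<And>i. i \<in> I \<Longrightarrow> \<beta> i > 0" "\<And>i. i \<in> I \<Longrightarrow> \<gamma> i \<ge> 1"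
    and k: "\<alpha> j + \<beta> j \<ge> real k + 2" and m: "m \<ge> 1"
  shows "fact (m + k) * P I 1 \<le> fact (k + 1) * P I m"
  using m
proof (induction m rule: dec_induct)
  case base
  show ?case by (simp add: add.commute)
next
  case (step m)
  have nonneg: "P I m \<ge> 0" unfolding P_def by (intro prod_nonneg) auto
  have x1: "\<alpha> i * real m + \<beta> i \<ge> 1" if "i \<in> I" for i
    using mult_mono[of 1 "\<alpha> i" 1 "real m"] ge[OF that] step.hyps by auto
  have "real (m + k + 1) \<le> \<alpha> j * real m + \<beta> j"
  proof -
    have "1 * (real m - 1) \<le> \<alpha> j * (real m - 1)"
      using ge(1)[OF j] step.hyps by (intro mult_right_mono) auto
    then show ?thesis using k by (simp add: algebra_simps)
  qed
  then have "real (m + k + 1) * P I m \<le> (\<alpha> j * real m + \<beta> j) * P I m"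
    by (rule mult_right_mono[OF _ nonneg])
  also have "\<dots> \<le> (\<Prod>i\<in>I. Gamma ((\<alpha> i * real m + \<beta> i) + \<alpha> i) powr \<gamma> i)"
    unfolding P_def by (rule prod_Gamma_powr_growth[OF fin j]) (use x1 ge in auto)
  also have "\<dots> = P I (Suc m)" unfolding P_def by (simp add: algebra_simps)
  finally have "fact (k + 1) * (real (m + k + 1) * P I m) \<le> fact (k + 1) * P I (Suc m)"
    by (rule mult_left_mono) simp
  moreover have "real (m + k + 1) * (fact (m + k) * P I 1) \<le> real (m + k + 1) * (fact (k + 1) * P I m)"
    by (rule mult_left_mono[OF step.IH]) simp
  moreover have "fact (Suc m + k) * P I 1 = real (m + k + 1) * (fact (m + k) * P I 1)"
    by (simp add: mult.assoc)
  ultimately show ?case by (simp only: mult.left_commute)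
qed

section \<open>The Le Roy function\<close>

theorem theorem6:
  fixes n :: nat and \<alpha> \<beta> \<gamma> :: "nat \<Rightarrow> real"
  assumes "n \<ge> 1"
    and "\<And>i. i \<in> {1..n} \<Longrightarrow> min (\<alpha> i) (\<gamma> i) \<ge> 1"
    and "\<And>i. i \<in> {1..n} \<Longrightarrow> \<beta> i > 0"
    and "\<exists>j\<in>{1..n}. \<alpha> j + \<beta> j \<ge> 2"
  shows "((exp 1 - 1) * (\<Prod>i=1..n. Gamma (\<beta> i) powr \<gamma> i)
            < (\<Prod>i=1..n. Gamma (\<alpha> i + \<beta> i) powr \<gamma> i)
          \<longrightarrow> starlike_in_disk (le_roy_F n \<alpha> \<beta> \<gamma>) (1/2)) \<and>
         (2 * (exp 1 - 1) * (\<Prod>i=1..n. Gamma (\<beta> i) powr \<gamma> i)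
            < (\<Prod>i=1..n. Gamma (\<alpha> i + \<beta> i) powr \<gamma> i)
          \<and> (\<forall>i\<in>{1..n}. \<beta> i \<ge> 2)
          \<longrightarrow> convex_in_disk (le_roy_F n \<alpha> \<beta> \<gamma>) (1/2))"
proof -
  define P where "P m = (\<Prod>i=1..n. Gamma (\<alpha> i * real m + \<beta> i) powr \<gamma> i)" for m :: nat
  define a where "a m = P 0 / P m" for m
  have ge: "\<alpha> i \<ge> 1" "\<beta> i > 0" "\<gamma> i \<ge> 1" if "i \<in> {1..n}" for i
    using assms(2,3)[OF that] by auto
  have Ppos: "P m > 0" for m
    unfolding P_def
  proof (rule prod_pos)
    fix i assume "i \<in> {1..n}"
    then have "\<alpha> i * real m + \<beta> i > 0"
      using ge[of i] by (intro add_nonneg_pos mult_nonneg_nonneg) auto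
    from Gamma_real_pos[OF this] show "Gamma (\<alpha> i * real m + \<beta> i) powr \<gamma> i > 0" by simp
  qed
  have P0: "P 0 = (\<Prod>i=1..n. Gamma (\<beta> i) powr \<gamma> i)"
    and P1: "P 1 = (\<Prod>i=1..n. Gamma (\<alpha> i + \<beta> i) powr \<gamma> i)"
    by (simp_all add: P_def)
  have a0: "a 0 = 1" and apos: "a m > 0" for m
    using Ppos[of 0] Ppos[of m] by (auto simp: a_def)
  have a_le: "a m \<le> fact (k + 1) * a 1 / fact (m + k)"
    if "j \<in> {1..n}" "\<alpha> j + \<beta> j \<ge> real k + 2" "m \<ge> 1" for j k m
  proof -
    have "fact (m + k) * P 1 \<le> fact (k + 1) * P m"
      unfolding P_def by (rule prod_Gamma_powr_ge_fact[where j = j]) (use ge that in auto)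
    then have "P 0 * (fact (m + k) * P 1) \<le> P 0 * (fact (k + 1) * P m)"
      by (rule mult_left_mono) (use Ppos[of 0] in simp)
    moreover have "P 0 / P m \<le> fact (k + 1) * (P 0 / P 1) / fact (m + k)
        \<longleftrightarrow> P 0 * (fact (m + k) * P 1) \<le> P 0 * (fact (k + 1) * P m)"
      using Ppos[of m] Ppos[of 1] by (simp add: field_simps del: fact_Suc)
    ultimately show ?thesis by (simp only: a_def)
  qed
  from assms(4) obtain j where j: "j \<in> {1..n}" "\<alpha> j + \<beta> j \<ge> 2" by blast
  have a_le': "a m \<le> a 1 / fact m" if "m \<ge> 1" for m
    using a_le[OF j(1), of 0 m] j(2) that by simp
  have norm_a: "norm (complex_of_real (a m)) = a m" for m
    using apos[of m] by simp
  have F: "le_roy_F n \<alpha> \<beta> \<gamma> z = z * (\<Sum>m. of_real (a m) * z ^ m)" for z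
  proof -
    have "summable (\<lambda>m. z ^ m / of_real (P m))"
    proof (rule summable_comparison_test'[of "\<lambda>m. a 1 / P 0 * (norm z ^ m / fact m)" 1])
      show "summable (\<lambda>m. a 1 / P 0 * (norm z ^ m / fact m))"
        using summable_exp[of "norm z"] by (intro summable_mult) (simp add: field_simps)
      show "norm (z ^ m / complex_of_real (P m)) \<le> a 1 / P 0 * (norm z ^ m / fact m)" if "m \<ge> 1" for m
      proof -
        have "norm (z ^ m / complex_of_real (P m)) = a m * (norm z ^ m / P 0)"
          using Ppos[of m] Ppos[of 0] by (simp add: a_def norm_divide norm_power)
        also have "\<dots> \<le> a 1 / fact m * (norm z ^ m / P 0)"
          using a_le'[OF that] Ppos[of 0] by (intro mult_right_mono) auto
        finally show ?thesis by (simp add: field_simps)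
      qed
    qed
    from suminf_mult[OF this, of "of_real (P 0)"] show ?thesis
      unfolding le_roy_F_def P0[symmetric] P_def[symmetric] by (simp add: a_def mult.assoc)
  qed
  show ?thesis
  proof (intro conjI impI)
    assume "(exp 1 - 1) * (\<Prod>i=1..n. Gamma (\<beta> i) powr \<gamma> i)
      < (\<Prod>i=1..n. Gamma (\<alpha> i + \<beta> i) powr \<gamma> i)"
    then have "a 1 * (exp 1 - 1) < 1"
      using Ppos[of 1] by (simp only: P0[symmetric] P1[symmetric] a_def) (simp add: field_simps)
    note S = weighted_coeff_sum_half[of a, OF a0 less_imp_le[OF apos] a_le' this]
    show "starlike_in_disk (le_roy_F n \<alpha> \<beta> \<gamma>) (1/2)"
      by (rule starlike_criterion[where b = "\<lambda>m. of_real (a m)"])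
         (use S a0 F in \<open>simp_all only: norm_a, simp_all\<close>)
  next
    assume H: "2 * (exp 1 - 1) * (\<Prod>i=1..n. Gamma (\<beta> i) powr \<gamma> i)
        < (\<Prod>i=1..n. Gamma (\<alpha> i + \<beta> i) powr \<gamma> i) \<and> (\<forall>i\<in>{1..n}. \<beta> i \<ge> 2)"
    then have A: "2 * a 1 * (exp 1 - 1) < 1"
      using Ppos[of 1] by (simp only: P0[symmetric] P1[symmetric] a_def) (simp add: field_simps)
    have le: "real (m + 1) * a m \<le> 2 * a 1 / fact m" if m: "m \<ge> 1" for m
    proof -
      have "\<alpha> j + \<beta> j \<ge> real 1 + 2" using H j(1) ge(1)[OF j(1)] by force
      from a_le[OF j(1) this m] have "a m \<le> 2 * a 1 / (real (m + 1) * fact m)" by simp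
      then have "real (m + 1) * a m \<le> real (m + 1) * (2 * a 1 / (real (m + 1) * fact m))"
        by (rule mult_left_mono) simp
      also have "\<dots> = 2 * a 1 / fact m" by simp
      finally show ?thesis .
    qed
    have "real (m + 1) * a m \<ge> 0" for m using apos[of m] by simp
    note S = weighted_coeff_sum_half[of "\<lambda>m. real (m + 1) * a m", OF _ this le A]
    show "convex_in_disk (le_roy_F n \<alpha> \<beta> \<gamma>) (1/2)"
      by (rule convex_criterion[where b = "\<lambda>m. of_real (a m)"])
         (use S a0 F in \<open>simp_all only: norm_a, simp_all\<close>)
  qed
qed

end
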